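(* Let $\varphi\colon\mathcal{A}\to\mathcal{A}^*$ be a substitution, let $x\in\mathcal{A}^\omega$ with $\varphi(x)=x$, and let $X$ be the orbit closure of $x$. Then there exist an integer $m\ge 1$, with $\tau=\varphi^m$, and a finite set of words $W\subset\mathcal{A}^*$ such that every transitive subsystem $Y\subseteq X$ is the orbit closure of some sequence $y\in X$ which is a suffix of a sequence of the form $$\cdots\tau^2(v)\tau(v)\,v\,a\,b\,w\,\tau(w)\,\tau^2(w)\cdots$$ for some $v\in W$, $w\in W\setminus\{\epsilon\}$ and $a,b\in\mathcal{A}\cup\{\epsilon\}$.
   Context: An alphabet is a finite nonempty set $\mathcal{A}$; $\mathcal{A}^*$ denotes finite words (including the empty word $\epsilon$), $\mathcal{A}^\omega$ the sequences $(x_n)_{n\ge0}$, with product topology and shift $T((x_n)_n)=(x_{n+1})_n$. A subsystem is a closed $T$-invariant subset; it is transitive if it is the orbit closure $\overline{\{T^n y:n\ge0\}}$ of one of its points $y$. A substitution is a map $\varphi\colon\mathcal{A}\to\mathcal{A}^*$ extended to words and sequences by concatenation; all substitutions are assumed growing: $|\varphi^n(a)|\to\infty$ for every letter $a$. The displayed object is the (generally biinfinite) concatenation with the left-infinite part $\cdots\tau^2(v)\tau(v)v$ (empty if $v=\epsilon$) and the right-infinite part $w\tau(w)\tau^2(w)\cdots$; a one-sided sequence $y$ is a suffix of it if $y$ is obtained by reading it from some position onward. *)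

theory Defs
  imports "HOL-Analysis.Function_Topology"
begin

definition seq_topology :: "(nat \<Rightarrow> 'a) topology" where
  "seq_topology = product_topology (\<lambda>_. discrete_topology UNIV) UNIV"

definition shift :: "(nat \<Rightarrow> 'a) \<Rightarrow> nat \<Rightarrow> 'a" where
  "shift x = (\<lambda>n. x (Suc n))"

definition orbit_closure :: "(nat \<Rightarrow> 'a) \<Rightarrow> (nat \<Rightarrow> 'a) set" where
  "orbit_closure y = seq_topology closure_of {(shift ^^ n) y | n. True}"

definition subsystem :: "(nat \<Rightarrow> 'a) set \<Rightarrow> bool" where
  "subsystem Y \<longleftrightarrow> closedin seq_topology Y \<and> shift ` Y \<subseteq> Y"

definition transitive_subsystem :: "(nat \<Rightarrow> 'a) set \<Rightarrow> bool" where
  "transitive_subsystem Y \<longleftrightarrow> subsystem Y \<and> (\<exists>y\<in>Y. Y = orbit_closure y)"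

text \<open>The infinite concatenation of the words \<open>u 0\<close>, \<open>u 1\<close>, \<open>u 2\<close>, \<dots>; it is meaningful only
  when infinitely many of these words are nonempty. The \<open>n\<close>-th letter is read off the
  shortest finite concatenation that is long enough to contain it.\<close>

definition concat_seq :: "(nat \<Rightarrow> 'a list) \<Rightarrow> nat \<Rightarrow> 'a" where
  "concat_seq u n =
     concat (map u [0..<(LEAST k. n < length (concat (map u [0..<k])))]) ! n"

definition subst_word :: "('a \<Rightarrow> 'a list) \<Rightarrow> 'a list \<Rightarrow> 'a list" where
  "subst_word \<phi> w = concat (map \<phi> w)"

definition subst_seq :: "('a \<Rightarrow> 'a list) \<Rightarrow> (nat \<Rightarrow> 'a) \<Rightarrow> nat \<Rightarrow> 'a" where
  "subst_seq \<phi> x = concat_seq (\<lambda>n. \<phi> (x n))"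

definition subst_power :: "('a \<Rightarrow> 'a list) \<Rightarrow> nat \<Rightarrow> 'a \<Rightarrow> 'a list" where
  "subst_power \<phi> m a = (subst_word \<phi> ^^ m) [a]"

definition growing :: "('a \<Rightarrow> 'a list) \<Rightarrow> bool" where
  "growing \<phi> \<longleftrightarrow> (\<forall>a. filterlim (\<lambda>n. length (subst_power \<phi> n a)) at_top sequentially)"

text \<open>The concatenation \<open>\<cdots>\<tau>\<^sup>2(v)\<tau>(v) v a b w \<tau>(w) \<tau>\<^sup>2(w)\<cdots>\<close> is represented by its sequence of
  blocks indexed by the integers: block \<open>0\<close> is \<open>a b\<close>, the blocks \<open>1, 2, \<dots>\<close> are
  \<open>w, \<tau>(w), \<dots>\<close> and the blocks \<open>-1, -2, \<dots>\<close> are \<open>v, \<tau>(v), \<dots>\<close>. If \<open>v\<close> is the empty word, all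
  blocks of negative index are empty, and so is the left part of the concatenation.\<close>

definition blocks ::
    "('a \<Rightarrow> 'a list) \<Rightarrow> 'a list \<Rightarrow> 'a list \<Rightarrow> 'a list \<Rightarrow> 'a list \<Rightarrow> int \<Rightarrow> 'a list" where
  "blocks \<tau> v a b w i =
     (if i < 0 then (subst_word \<tau> ^^ nat (- i - 1)) v
      else if i = 0 then a @ b
      else (subst_word \<tau> ^^ nat (i - 1)) w)"

text \<open>A position in a concatenation of integer-indexed blocks is a pair of a block index \<open>k\<close> and
  an offset \<open>j\<close> inside the \<open>k\<close>-th block.\<close>

definition suffix_of_blocks :: "(nat \<Rightarrow> 'a) \<Rightarrow> (int \<Rightarrow> 'a list) \<Rightarrow> bool" where
  "suffix_of_blocks y B \<longleftrightarrow>
     (\<exists>k j. j < length (B k) \<and> y = (shift ^^ j) (concat_seq (\<lambda>i. B (k + int i))))"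

definition letters_or_empty :: "'a list set" where
  "letters_or_empty = insert [] (range (\<lambda>c. [c]))"

end

theory Submission
  imports Defs "HOL-Library.Sublist" "HOL-Library.Omega_Words_Fun"
begin

text \<open>Desubstituting a point \<open>y\<close> of \<open>X\<close> repeatedly along \<open>\<tau>\<close> yields letters \<open>c k\<close> with
  \<open>\<tau> (c (k + 1)) = p k \<cdot> c k \<cdot> t k\<close>, and \<open>y\<close> starts with \<open>c 0 \<cdot> t 0 \<cdot> \<tau>(t 1) \<cdot> \<tau>\<^sup>2(t 2) \<cdots>\<close>. Let \<open>a\<close> be a letter
  equal to infinitely many \<open>c k\<close>.

  If infinitely many \<open>t k\<close> contain a letter from which \<open>a\<close> can be reached, then \<open>a\<close> occurs twice in some
  \<open>\<tau>\<^sup>n(a)\<close>, so after replacing \<open>\<tau>\<close> by a power \<open>\<tau>(a) = v a w\<close> with \<open>a\<close> in \<open>w\<close>; both \<open>y\<close> and \<open>a w \<tau>(w) \<cdots>\<close>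
  have as factors exactly the factors of the words \<open>\<tau>\<^sup>n(a)\<close>, so they have the same orbit closure.

  Otherwise, from some index on, \<open>c k\<close> is the last letter of \<open>\<tau> (c (k + 1))\<close> from which \<open>a\<close> can be reached,
  hence (for a suitable power) \<open>\<tau>(a) = v a w\<close> where \<open>a\<close> cannot be reached from \<open>w\<close>, and \<open>y\<close> itself is
  a suffix of \<open>\<cdots>\<tau>(v) v a w \<tau>(w)\<cdots>\<close>. If \<open>w\<close> is empty, what follows \<open>a\<close> is fixed by \<open>\<tau>\<close>, so it is
  \<open>d q \<tau>(q) \<cdots>\<close> with \<open>\<tau>(d) = d q\<close>. A single power of \<open>\<phi>\<close> serves all letters, since each of the three
  properties of a letter passes to further powers.\<close>

hide_const (open) Sublist.prefix Sublist.suffix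
declare build_cons [simp del] build_append [simp del]

section \<open>Sequences and their factors\<close>

lemma funpow_shift: "(shift ^^ n) y = suffix n y"
  by (induction n) (simp_all add: shift_def suffix_def)

text \<open>Occurrences are encoded by splitting \<open>y\<close> into a word followed by a
  sequence, so that the laws of \<open>\<frown>\<close> apply to them directly.\<close>

definition factors :: "(nat \<Rightarrow> 'a) \<Rightarrow> 'a list set" where
  "factors y = {l. \<exists>p z. y = (p @ l) \<frown> z}"

lemma factorsI: "y = (p @ l @ s) \<frown> z \<Longrightarrow> l \<in> factors y"
  unfolding factors_def by (auto intro!: exI[of _ p] exI[of _ "s \<frown> z"])

lemma prefix_in_factors: "prefix n y \<in> factors y"
  by (rule factorsI[of _ "[]" _ "[]" "suffix n y"]) simp

lemma sublist_in_factors: "l \<in> factors y \<Longrightarrow> sublist l' l \<Longrightarrow> l' \<in> factors y"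
proof -
  assume "l \<in> factors y" "sublist l' l"
  then obtain p z ps ss where "y = (p @ l) \<frown> z" "l = ps @ l' @ ss"
    by (auto simp: factors_def sublist_def)
  then have "y = ((p @ ps) @ l' @ ss) \<frown> z" by simp
  then show ?thesis by (rule factorsI)
qed

lemma prefix_in_factors_iff: "prefix n z \<in> factors y \<longleftrightarrow> (\<exists>k. \<forall>i<n. y (k + i) = z i)"
proof
  assume "prefix n z \<in> factors y"
  then obtain p s where y: "y = (p @ prefix n z) \<frown> s" by (auto simp: factors_def)
  have "\<forall>i<n. y (length p + i) = z i"
    unfolding y by (simp add: nth_append)
  then show "\<exists>k. \<forall>i<n. y (k + i) = z i" by blast
next
  assume "\<exists>k. \<forall>i<n. y (k + i) = z i"
  then obtain k where k: "\<forall>i<n. y (k + i) = z i" by blast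
  have "prefix n z = prefix n (suffix k y)"
    using k by (intro nth_equalityI) auto
  moreover have "prefix k y @ prefix n (suffix k y) = prefix (k + n) y"
    by (simp add: subsequence_append)
  ultimately have "(prefix k y @ prefix n z) \<frown> suffix (k + n) y = y" by simp
  then have "y = (prefix k y @ prefix n z @ []) \<frown> suffix (k + n) y" by simp
  then show "prefix n z \<in> factors y" by (rule factorsI)
qed

section \<open>Orbit closures in terms of factors\<close>

lemma openin_cylinder: "openin seq_topology {u. \<forall>i<n. u i = z i}"
proof -
  have "openin seq_topology (\<Pi>\<^sub>E i\<in>UNIV. if i < n then {z i} else UNIV)"
    unfolding seq_topology_def by (rule product_topology_basis) auto
  moreover have "(\<Pi>\<^sub>E i\<in>UNIV. if i < n then {z i} else UNIV) = {u. \<forall>i<n. u i = z i}"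
    by (force simp: PiE_UNIV_domain split: if_splits)
  ultimately show ?thesis by simp
qed

lemma cylinder_in_open:
  assumes "openin seq_topology T" "z \<in> T"
  shows "\<exists>n. {u. \<forall>i<n. u i = z i} \<subseteq> T"
proof -
  from assms obtain U where U: "z \<in> (\<Pi>\<^sub>E i\<in>UNIV. U i)"
    "finite {i. U i \<noteq> topspace (discrete_topology UNIV)}" "(\<Pi>\<^sub>E i\<in>UNIV. U i) \<subseteq> T"
    unfolding seq_topology_def by (blast dest: product_topology_open_contains_basis)
  from U(2) obtain n where n: "\<And>i. U i \<noteq> UNIV \<Longrightarrow> i < n"
    by (auto simp: finite_nat_set_iff_bounded)
  have "u \<in> (\<Pi>\<^sub>E i\<in>UNIV. U i)" if "\<forall>i<n. u i = z i" for u
  proof (unfold PiE_UNIV_domain, rule Pi_I)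
    fix i show "u i \<in> U i"
    proof (cases "i < n")
      case True
      with that U(1) show ?thesis by (auto simp: PiE_UNIV_domain)
    next
      case False
      with n have "U i = UNIV" by blast
      then show ?thesis by simp
    qed
  qed
  then have "{u. \<forall>i<n. u i = z i} \<subseteq> T"
    using U(3) by (intro subsetI) (simp add: subset_iff)
  then show ?thesis ..
qed

text \<open>Cylinders are open and form a neighbourhood base, so \<open>z\<close> is adherent to the
  orbit exactly when each of its prefixes is read somewhere in \<open>y\<close>. From here on the
  topology enters only through this criterion.\<close>

lemma orbit_closure_iff: "z \<in> orbit_closure y \<longleftrightarrow> (\<forall>n. prefix n z \<in> factors y)"
proof -
  have "z \<in> orbit_closure y \<longleftrightarrow>
      (\<forall>T. z \<in> T \<and> openin seq_topology T \<longrightarrow> (\<exists>k. suffix k y \<in> T))"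
    unfolding orbit_closure_def funpow_shift in_closure_of
    by (auto simp: seq_topology_def PiE_UNIV_domain)
  also have "\<dots> \<longleftrightarrow> (\<forall>n. \<exists>k. suffix k y \<in> {u. \<forall>i<n. u i = z i})"
  proof (intro iffI allI impI)
    fix n
    assume "\<forall>T. z \<in> T \<and> openin seq_topology T \<longrightarrow> (\<exists>k. suffix k y \<in> T)"
    from this[rule_format, of "{u. \<forall>i<n. u i = z i}"]
    show "\<exists>k. suffix k y \<in> {u. \<forall>i<n. u i = z i}" by (simp add: openin_cylinder)
  next
    fix T
    assume *: "\<forall>n. \<exists>k. suffix k y \<in> {u. \<forall>i<n. u i = z i}" and "z \<in> T \<and> openin seq_topology T"
    then obtain n where "{u. \<forall>i<n. u i = z i} \<subseteq> T" using cylinder_in_open by blast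
    moreover from * obtain k where "suffix k y \<in> {u. \<forall>i<n. u i = z i}" by blast
    ultimately have "suffix k y \<in> T" by (rule subsetD)
    then show "\<exists>k. suffix k y \<in> T" ..
  qed
  finally show ?thesis by (simp add: prefix_in_factors_iff)
qed

lemma orbit_closure_self: "y \<in> orbit_closure y"
  by (simp add: orbit_closure_iff prefix_in_factors)

lemma factors_orbit_closure: "z \<in> orbit_closure y \<Longrightarrow> factors z \<subseteq> factors y"
proof
  fix l assume z: "z \<in> orbit_closure y" and "l \<in> factors z"
  then obtain p s where s: "z = (p @ l) \<frown> s" by (auto simp: factors_def)
  have "prefix (length (p @ l)) z = p @ l"
    unfolding s by (rule prefix_conc_length)
  then have "p @ l \<in> factors y"
    using z unfolding orbit_closure_iff by metis
  then show "l \<in> factors y" by (rule sublist_in_factors) simp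
qed

lemma orbit_closure_eqI:
  assumes "z \<in> orbit_closure y" "y \<in> orbit_closure z"
  shows "orbit_closure y = orbit_closure z"
  using assms[THEN factors_orbit_closure] by (force simp: orbit_closure_iff)

section \<open>Pigeonhole and compactness over a finite alphabet\<close>

lemma recurrent_value:
  fixes f :: "nat \<Rightarrow> 'a::finite"
  shows "\<exists>a. \<exists>\<^sub>\<infinity>k. f k = a"
proof -
  have "\<exists>\<^sub>\<infinity>k. \<exists>a\<in>UNIV. f k = a" by (simp add: INFM_nat)
  then have "\<exists>a\<in>UNIV. \<exists>\<^sub>\<infinity>k. f k = a"
    by (subst (asm) frequently_bex_finite_distrib) auto
  then show ?thesis by blast
qed

text \<open>Compactness of the full shift: \<open>z\<close> is an accumulation point of the
  sequences \<open>u k\<close>. Prefixes are prolonged one letter at a time, always by a letter that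
  keeps infinitely many \<open>k\<close>.\<close>

lemma konig_sequence:
  fixes u :: "nat \<Rightarrow> nat \<Rightarrow> 'a::finite"
  obtains z where "\<And>n. \<exists>\<^sub>\<infinity>k. prefix n (u k) = prefix n z"
proof -
  let ?P = "\<lambda>n l. length l = n \<and> (\<exists>\<^sub>\<infinity>k. prefix n (u k) = l)"
  let ?Q = "\<lambda>(n::nat) l l'. \<exists>a. l' = l @ [a]"
  have "\<exists>f. \<forall>n. ?P n (f n) \<and> ?Q n (f n) (f (Suc n))"
  proof (rule dependent_nat_choice)
    show "\<exists>l. ?P 0 l" by (auto simp: INFM_nat)
  next
    fix l n assume l: "?P n l"
    then have "\<exists>\<^sub>\<infinity>k. \<exists>a\<in>UNIV. prefix (Suc n) (u k) = l @ [a]"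
      by (auto elim!: frequently_elim1)
    then have "\<exists>a\<in>UNIV. \<exists>\<^sub>\<infinity>k. prefix (Suc n) (u k) = l @ [a]"
      by (subst (asm) frequently_bex_finite_distrib) auto
    then obtain a where "\<exists>\<^sub>\<infinity>k. prefix (Suc n) (u k) = l @ [a]" by blast
    then show "\<exists>l'. ?P (Suc n) l' \<and> ?Q n l l'" using l by (intro exI[of _ "l @ [a]"]) simp
  qed
  then obtain f where f: "\<And>n. ?P n (f n)" "\<And>n. ?Q n (f n) (f (Suc n))" by blast
  define z where "z n = f (Suc n) ! n" for n
  have "f n = prefix n z" for n
  proof (induction n)
    case (Suc n)
    from f(2) obtain a where a: "f (Suc n) = f n @ [a]" by blast
    with f(1)[of n] have "z n = a" by (simp add: z_def nth_append)
    with a Suc show ?case by simp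
  qed (use f(1)[of 0] in simp)
  with f(1) that show thesis by auto
qed

section \<open>Infinite concatenations\<close>

lemma concat_map_upt_add:
  "concat (map u [0..<k + n]) = concat (map u [0..<k]) @ concat (map (\<lambda>i. u (k + i)) [0..<n])"
  by (induction n) simp_all

text \<open>Longer finite concatenations extend shorter ones, so any sufficiently large
  \<open>k\<close> may replace the least one in the definition.\<close>

lemma concat_seq_nth:
  assumes "n < length (concat (map u [0..<k]))"
  shows "concat_seq u n = concat (map u [0..<k]) ! n"
proof -
  let ?L = "LEAST k. n < length (concat (map u [0..<k]))"
  have L: "n < length (concat (map u [0..<?L]))" "?L \<le> k"
    using assms by (rule LeastI, rule Least_le)
  then obtain j where "k = ?L + j" using le_Suc_ex by blast
  then have "concat (map u [0..<k]) =
      concat (map u [0..<?L]) @ concat (map (\<lambda>i. u (?L + i)) [0..<j])"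
    by (simp only: concat_map_upt_add)
  with L(1) show ?thesis
    unfolding concat_seq_def by (simp only: nth_append if_True)
qed

text \<open>Each block from \<open>N\<close> on adds at least one letter. The threshold
  \<open>N\<close> leaves room for empty initial blocks, which arise in the biinfinite concatenation
  when \<open>v\<close> is empty.\<close>

lemma length_concat_ge:
  assumes "\<And>i. i \<ge> N \<Longrightarrow> u i \<noteq> []"
  shows "k \<le> length (concat (map u [0..<N + k]))"
proof (induction k)
  case (Suc k)
  have "length (u (N + k)) > 0" using assms by simp
  with Suc show ?case by (simp del: length_greater_0_conv)
qed simp

lemma long_concat:
  assumes "\<And>i. i \<ge> N \<Longrightarrow> u i \<noteq> []"
  shows "\<exists>k. n < length (concat (map u [0..<k]))"
  using length_concat_ge[of N u "Suc n", OF assms] by (meson Suc_le_lessD)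

text \<open>Identifies a limit through its finite approximations: the remainder \<open>s\<close> may
  vary with \<open>k\<close>, provided the lengths are unbounded.\<close>

lemma concat_seq_eqI:
  assumes "\<And>n. \<exists>k s. n < length (concat (map u [0..<k])) \<and> z = concat (map u [0..<k]) \<frown> s"
  shows "concat_seq u = z"
proof
  fix n
  from assms obtain k s where "n < length (concat (map u [0..<k]))" "z = concat (map u [0..<k]) \<frown> s"
    by blast
  then show "concat_seq u n = z n" by (simp add: concat_seq_nth)
qed

lemma concat_seq_split:
  assumes "\<And>i. i \<ge> N \<Longrightarrow> u i \<noteq> []"
  shows "concat_seq u = concat (map u [0..<k]) \<frown> concat_seq (\<lambda>i. u (k + i))"
proof
  fix n
  let ?l = "concat (map u [0..<k])"
  show "concat_seq u n = (?l \<frown> concat_seq (\<lambda>i. u (k + i))) n"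
  proof (cases "n < length ?l")
    case False
    have "\<exists>j. n - length ?l < length (concat (map (\<lambda>i. u (k + i)) [0..<j]))"
      by (rule long_concat[of N]) (simp add: assms)
    then obtain j where j: "n - length ?l < length (concat (map (\<lambda>i. u (k + i)) [0..<j]))" ..
    with False have "n < length (concat (map u [0..<k + j]))"
      unfolding concat_map_upt_add length_append by linarith
    then have "concat_seq u n = concat (map u [0..<k + j]) ! n"
      by (rule concat_seq_nth)
    also have "\<dots> = concat (map (\<lambda>i. u (k + i)) [0..<j]) ! (n - length ?l)"
      using False by (simp only: concat_map_upt_add nth_append if_False)
    also have "\<dots> = (?l \<frown> concat_seq (\<lambda>i. u (k + i))) n"
      using False concat_seq_nth[OF j] by (simp only: conc_snd not_False_eq_True)
    finally show ?thesis .
  qed (simp add: concat_seq_nth)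
qed

lemma concat_seq_position:
  assumes "\<And>i. i \<ge> N \<Longrightarrow> u i \<noteq> []"
  shows "\<exists>r j. j < length (u r) \<and> J = length (concat (map u [0..<r])) + j \<and>
    suffix J (concat_seq u) = suffix j (concat_seq (\<lambda>i. u (r + i)))"
proof -
  let ?P = "\<lambda>k. J < length (concat (map u [0..<k]))"
  \<comment> \<open>\<open>K\<close> is the least number of blocks that cover position
    \<open>J\<close>, so the last of them, with index \<open>r\<close>, contains it.\<close>
  define K where "K = (LEAST k. ?P k)"
  have K: "?P K" unfolding K_def using long_concat[of N u J] assms by (auto intro: LeastI_ex)
  then obtain r where r: "K = Suc r" by (cases K) auto
  have "\<not> ?P r" using not_less_Least[of r ?P] r K_def by simp
  then obtain j where j: "J = length (concat (map u [0..<r])) + j"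
    by (metis le_Suc_ex not_less)
  have "j < length (u r)" using K unfolding r j by simp
  moreover have "suffix J (concat_seq u) = suffix j (concat_seq (\<lambda>i. u (r + i)))"
    using concat_seq_split[of N u r] assms j by simp
  ultimately show ?thesis using j by blast
qed

section \<open>Nonerasing substitutions\<close>

lemma subst_word_Nil [simp]: "subst_word \<tau> [] = []"
  by (simp add: subst_word_def)

lemma subst_word_append [simp]: "subst_word \<tau> (u @ v) = subst_word \<tau> u @ subst_word \<tau> v"
  by (simp add: subst_word_def)

lemma subst_word_singleton [simp]: "subst_word \<tau> [a] = \<tau> a"
  by (simp add: subst_word_def)

lemma subst_iter_Nil [simp]: "(subst_word \<tau> ^^ n) [] = []"
  by (induction n) simp_all

lemma subst_iter_append [simp]:
  "(subst_word \<tau> ^^ n) (u @ v) = (subst_word \<tau> ^^ n) u @ (subst_word \<tau> ^^ n) v"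
  by (induction n) simp_all

lemma subst_iter_Cons:
  "(subst_word \<tau> ^^ n) (a # v) = (subst_word \<tau> ^^ n) [a] @ (subst_word \<tau> ^^ n) v"
  using subst_iter_append[of n \<tau> "[a]" v] by simp

lemma subst_iter_concat:
  "(subst_word \<tau> ^^ n) (concat us) = concat (map (subst_word \<tau> ^^ n) us)"
  by (induction us) simp_all

lemma subst_iter_add: "(subst_word \<tau> ^^ m) ((subst_word \<tau> ^^ n) w) = (subst_word \<tau> ^^ (m + n)) w"
  by (simp add: funpow_add)

lemma subst_iter_Suc_singleton: "(subst_word \<tau> ^^ Suc n) [a] = (subst_word \<tau> ^^ n) (\<tau> a)"
  by (simp add: funpow_swap1 del: funpow.simps add: funpow_Suc_right)

lemma subst_iter_sublist:
  "sublist u v \<Longrightarrow> sublist ((subst_word \<tau> ^^ n) u) ((subst_word \<tau> ^^ n) v)"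
  unfolding sublist_def by (elim exE) (simp, blast)

lemma sublist_singleton: "a \<in> set w \<Longrightarrow> sublist [a] w"
  by (auto simp: sublist_def dest: split_list)

text \<open>Reachability between letters is transitive, with exponents adding up like lengths of
  paths.\<close>

lemma subst_iter_set_trans:
  assumes "b \<in> set ((subst_word \<tau> ^^ n) u)" "c \<in> set ((subst_word \<tau> ^^ m) [b])"
  shows "c \<in> set ((subst_word \<tau> ^^ (m + n)) u)"
  using set_mono_sublist[OF subst_iter_sublist[OF sublist_singleton[OF assms(1)], where n = m and \<tau> = \<tau>]]
    assms(2)
  unfolding subst_iter_add by (rule subsetD)

lemma subst_iter_cycle:
  assumes "c \<in> set ((subst_word \<tau> ^^ n) [c])"
  shows "c \<in> set ((subst_word \<tau> ^^ (q * n)) [c])"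
proof (induction q)
  case (Suc q)
  show ?case using subst_iter_set_trans[OF Suc assms] by simp
qed simp

lemma subst_word_power: "subst_word (subst_power \<phi> m) w = (subst_word \<phi> ^^ m) w"
proof (induction w)
  case (Cons a w)
  have "subst_word (subst_power \<phi> m) (a # w) =
      subst_power \<phi> m a @ subst_word (subst_power \<phi> m) w"
    by (simp add: subst_word_def)
  also have "\<dots> = (subst_word \<phi> ^^ m) [a] @ (subst_word \<phi> ^^ m) w"
    unfolding Cons by (simp add: subst_power_def)
  finally show ?case by (subst subst_iter_Cons)
qed simp

lemma subst_iter_power: "(subst_word (subst_power \<phi> m) ^^ n) w = (subst_word \<phi> ^^ (m * n)) w"
proof -
  have "subst_word (subst_power \<phi> m) = subst_word \<phi> ^^ m"
    by (rule ext) (rule subst_word_power)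
  then show ?thesis by (simp add: funpow_mult)
qed

lemma subst_power_power: "subst_power (subst_power \<phi> m) n = subst_power \<phi> (m * n)"
  by (rule ext) (simp add: subst_power_def[of "subst_power \<phi> m"] subst_iter_power, simp add: subst_power_def)

locale nonerasing =
  fixes \<tau> :: "'a \<Rightarrow> 'a list"
  assumes nonempty: "\<tau> a \<noteq> []"
begin

lemma subst_word_length: "length w \<le> length (subst_word \<tau> w)"
proof (induction w)
  case (Cons a w)
  have "length (\<tau> a) > 0" using nonempty by simp
  with Cons show ?case using subst_word_append[of \<tau> "[a]" w] by (simp del: length_greater_0_conv)
qed simp

lemma subst_iter_length: "length w \<le> length ((subst_word \<tau> ^^ n) w)"
proof (induction n)
  case (Suc n)
  then show ?case using subst_word_length[of "(subst_word \<tau> ^^ n) w"] by simp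
qed simp

lemma subst_iter_nonempty: "w \<noteq> [] \<Longrightarrow> (subst_word \<tau> ^^ n) w \<noteq> []"
  using subst_iter_length[of w n] by auto

lemma nonerasing_subst_power: "nonerasing (subst_power \<tau> m)"
  by unfold_locales (simp add: subst_power_def subst_iter_nonempty)

lemma subst_seq_conc: "subst_seq \<tau> (l \<frown> z) = subst_word \<tau> l \<frown> subst_seq \<tau> z"
proof -
  have "subst_seq \<tau> (l \<frown> z) = concat (map (\<lambda>n. \<tau> ((l \<frown> z) n)) [0..<length l]) \<frown>
      concat_seq (\<lambda>i. \<tau> ((l \<frown> z) (length l + i)))"
    unfolding subst_seq_def by (rule concat_seq_split[of 0]) (simp add: nonempty)
  moreover have "map (\<lambda>n. \<tau> ((l \<frown> z) n)) [0..<length l] = map \<tau> l"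
    by (rule nth_equalityI) auto
  ultimately show ?thesis by (simp add: subst_seq_def subst_word_def)
qed

lemma subst_seq_iter_conc:
  "(subst_seq \<tau> ^^ n) (l \<frown> z) = (subst_word \<tau> ^^ n) l \<frown> (subst_seq \<tau> ^^ n) z"
  by (induction n) (simp_all add: subst_seq_conc)

lemma subst_seq_iter_concat_seq:
  assumes "\<And>i. u i \<noteq> []"
  shows "(subst_seq \<tau> ^^ n) (concat_seq u) = concat_seq (\<lambda>i. (subst_word \<tau> ^^ n) (u i))"
proof (rule concat_seq_eqI[symmetric])
  fix N
  let ?u = "\<lambda>i. (subst_word \<tau> ^^ n) (u i)"
  obtain k where "N < length (concat (map ?u [0..<k]))"
    using long_concat[of 0 ?u] assms subst_iter_nonempty by blast
  moreover have "(subst_seq \<tau> ^^ n) (concat_seq u) =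
      (subst_seq \<tau> ^^ n) (concat (map u [0..<k]) \<frown> concat_seq (\<lambda>i. u (k + i)))"
    by (subst concat_seq_split[of 0 u k]) (simp_all add: assms)
  then have "(subst_seq \<tau> ^^ n) (concat_seq u) =
      concat (map ?u [0..<k]) \<frown> (subst_seq \<tau> ^^ n) (concat_seq (\<lambda>i. u (k + i)))"
    by (simp add: subst_seq_iter_conc subst_iter_concat comp_def)
  ultimately show "\<exists>k s. N < length (concat (map ?u [0..<k])) \<and>
      (subst_seq \<tau> ^^ n) (concat_seq u) = concat (map ?u [0..<k]) \<frown> s" by blast
qed

lemma subst_seq_power: "subst_seq (subst_power \<tau> m) x = (subst_seq \<tau> ^^ m) x"
proof -
  interpret pow: nonerasing "subst_power \<tau> m" by (rule nonerasing_subst_power)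
  let ?u = "\<lambda>n. subst_power \<tau> m (x n)"
  show ?thesis
    unfolding subst_seq_def[of "subst_power \<tau> m"]
  proof (rule concat_seq_eqI)
    fix N
    obtain k where "N < length (concat (map ?u [0..<k]))"
      using long_concat[of 0 ?u] pow.nonempty by blast
    moreover have "concat (map ?u [0..<k]) = (subst_word \<tau> ^^ m) (prefix k x)"
      unfolding subst_word_power[symmetric] by (simp add: subst_word_def subsequence_def comp_def)
    moreover have "(subst_seq \<tau> ^^ m) x = (subst_word \<tau> ^^ m) (prefix k x) \<frown> (subst_seq \<tau> ^^ m) (suffix k x)"
      unfolding subst_seq_iter_conc[symmetric] by simp
    ultimately have "N < length (concat (map ?u [0..<k])) \<and>
        (subst_seq \<tau> ^^ m) x = concat (map ?u [0..<k]) \<frown> (subst_seq \<tau> ^^ m) (suffix k x)"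
      by (simp only: simp_thms)
    then show "\<exists>k s. N < length (concat (map ?u [0..<k])) \<and>
        (subst_seq \<tau> ^^ m) x = concat (map ?u [0..<k]) \<frown> s" by blast
  qed
qed

text \<open>Continuity of the substitution on sequences: no letter is erased, so \<open>n\<close>
  letters determine at least \<open>n\<close> letters of the image.\<close>

lemma subst_seq_prefix_cong:
  assumes "prefix n y = prefix n z" "i < n"
  shows "subst_seq \<tau> y i = subst_seq \<tau> z i"
proof -
  have "subst_seq \<tau> v i = subst_word \<tau> (prefix n v) ! i" for v
  proof -
    have "i < length (subst_word \<tau> (prefix n v))"
      using subst_word_length[of "prefix n v"] assms(2) by simp
    moreover have "subst_seq \<tau> v = subst_word \<tau> (prefix n v) \<frown> subst_seq \<tau> (suffix n v)"
      unfolding subst_seq_conc[symmetric] by simp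
    ultimately show ?thesis by simp
  qed
  with assms(1) show ?thesis by simp
qed

end

text \<open>Every prefix of \<open>y\<close> occurs in \<open>x\<close>, hence in the image of a
  suffix of \<open>x\<close>, at an offset inside the image of its first letter. One offset serves
  all prefixes, and an accumulation point of these suffixes is the desired
  \<open>y'\<close>.\<close>

lemma desubstitute_orbit_closure:
  fixes \<tau> :: "'a::finite \<Rightarrow> 'a list"
  assumes "nonerasing \<tau>" "subst_seq \<tau> x = x" "y \<in> orbit_closure x"
  obtains y' p t where "y' \<in> orbit_closure x" "\<tau> (y' 0) = p @ y 0 # t"
    "suffix 1 y = t \<frown> subst_seq \<tau> (suffix 1 y')"
proof -
  interpret nonerasing \<tau> by fact
  let ?P = "\<lambda>n r j. j < length (\<tau> (x r)) \<and> (\<forall>i<n. subst_seq \<tau> (suffix r x) (j + i) = y i)"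
  have pos: "\<exists>r j. ?P n r j" for n
  proof -
    from assms(3) obtain k where k: "\<forall>i<n. x (k + i) = y i"
      unfolding orbit_closure_iff prefix_in_factors_iff by blast
    obtain r j where "j < length (\<tau> (x r))" and
      eq: "suffix k (subst_seq \<tau> x) = suffix j (concat_seq (\<lambda>i. \<tau> (x (r + i))))"
      using concat_seq_position[of 0 "\<lambda>i. \<tau> (x i)" k] nonempty unfolding subst_seq_def by blast
    moreover have "subst_seq \<tau> (suffix r x) (j + i) = y i" if "i < n" for i
      using that k fun_cong[OF eq, of i] by (simp add: subst_seq_def assms(2)[unfolded subst_seq_def])
    ultimately show ?thesis by blast
  qed
  \<comment> \<open>Offsets are bounded by \<open>J\<close>. If each \<open>j\<close> failed for
    some length \<open>f j\<close>, a prefix at least as long as all \<open>f j\<close> with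
    \<open>j \<le> J\<close> would have no offset at all.\<close>
  have "\<exists>j. \<forall>n. \<exists>r. ?P n r j"
  proof (rule ccontr)
    assume "\<not> ?thesis"
    then obtain f where f: "\<And>j r. \<not> ?P (f j) r j" by metis
    define J where "J = Max (range (\<lambda>a. length (\<tau> a)))"
    have J: "length (\<tau> a) \<le> J" for a by (simp add: J_def)
    obtain r j where rj: "?P (Max (f ` {..J})) r j" using pos by blast
    then have "j \<le> J" using J[of "x r"] by linarith
    then have "f j \<le> Max (f ` {..J})" by simp
    with rj have "?P (f j) r j" using less_le_trans by blast
    with f show False by blast
  qed
  then obtain j r where r: "\<And>n. ?P n (r n) j" by metis
  obtain y' where y': "\<And>n. \<exists>\<^sub>\<infinity>k. prefix n (suffix (r k) x) = prefix n y'"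
    using konig_sequence[of "\<lambda>k. suffix (r k) x"] by blast
  have ex: "\<exists>k\<ge>N. prefix n (suffix (r k) x) = prefix n y'" for n N
    using y'[of n] unfolding INFM_nat_le by blast
  have "y' \<in> orbit_closure x"
    unfolding orbit_closure_iff
  proof
    fix n
    obtain k where "prefix n (suffix (r k) x) = prefix n y'" using ex by blast
    moreover have "prefix n (suffix (r k) x) \<in> factors x"
      unfolding prefix_in_factors_iff by auto
    ultimately show "prefix n y' \<in> factors x" by simp
  qed
  moreover have "subst_seq \<tau> y' (j + i) = y i" for i
  proof -
    \<comment> \<open>\<open>r k\<close> gives agreement with \<open>y\<close> only at indices below
      \<open>k\<close>, so \<open>k\<close> must exceed \<open>i\<close>; the first
      \<open>j + i + 1\<close> letters then settle the image at index \<open>j + i\<close>.\<close>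
    obtain k where k: "k \<ge> Suc i" "prefix (j + i + 1) (suffix (r k) x) = prefix (j + i + 1) y'"
      using ex by blast
    with subst_seq_prefix_cong[OF k(2), of "j + i"] r[of k] show ?thesis by simp
  qed
  then have shift: "suffix j (subst_seq \<tau> y') = y" by (intro ext) simp
  have "j < length (\<tau> (y' 0))"
  proof -
    obtain k where k: "prefix 1 (suffix (r k) x) = prefix 1 y'" using ex by blast
    then show ?thesis using r[of k] by simp
  qed
  then have "drop j (\<tau> (y' 0)) \<noteq> []" by simp
  then obtain b t where bt: "drop j (\<tau> (y' 0)) = b # t" by (cases "drop j (\<tau> (y' 0))") auto
  have "prefix 1 y' \<frown> suffix 1 y' = y'" by (rule prefix_suffix[symmetric])
  then have "subst_seq \<tau> y' = \<tau> (y' 0) \<frown> subst_seq \<tau> (suffix 1 y')"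
    using subst_seq_conc[of "prefix 1 y'" "suffix 1 y'"] by (simp del: prefix_suffix)
  then have y: "y = (b # t) \<frown> subst_seq \<tau> (suffix 1 y')"
    using shift \<open>j < length (\<tau> (y' 0))\<close> bt by simp
  then have "y 0 = b" "suffix 1 y = t \<frown> subst_seq \<tau> (suffix 1 y')" by simp_all
  moreover have "\<tau> (y' 0) = take j (\<tau> (y' 0)) @ b # t"
    unfolding bt[symmetric] by simp
  ultimately show thesis using that by blast
qed

section \<open>Suffixes of the biinfinite concatenation\<close>

text \<open>The central stretch of the biinfinite concatenation thus appears as an iterate of
  \<open>c\<close>; the reversed list puts the highest power of \<open>\<tau>\<close>
  leftmost.\<close>

lemma subst_iter_occurrence:
  assumes "\<tau> c = p @ c # w"
  shows "(subst_word \<tau> ^^ n) [c] = concat (map (\<lambda>i. (subst_word \<tau> ^^ i) p) (rev [0..<n])) @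
    c # concat (map (\<lambda>i. (subst_word \<tau> ^^ i) w) [0..<n])"
proof (induction n)
  case (Suc n)
  have "(subst_word \<tau> ^^ Suc n) [c] = (subst_word \<tau> ^^ n) (p @ [c] @ w)"
    unfolding subst_iter_Suc_singleton assms by simp
  also have "\<dots> = (subst_word \<tau> ^^ n) p @ (subst_word \<tau> ^^ n) [c] @ (subst_word \<tau> ^^ n) w"
    by (simp only: subst_iter_append)
  finally show ?case unfolding Suc by simp
qed simp

context nonerasing
begin

text \<open>Reading starts at block \<open>-n\<close>: the left-hand side is the concatenation from
  there on, and \<open>P\<close> is the portion skipped before \<open>y\<close>.
  \<open>concat_seq_position\<close> converts the length of \<open>P\<close> into a block and an
  offset.\<close>

lemma suffix_of_blocksI:
  assumes "w \<noteq> []"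
    and "(concat (map (\<lambda>i. (subst_word \<tau> ^^ i) v) (rev [0..<n])) @ a @ b) \<frown>
      concat_seq (\<lambda>i. (subst_word \<tau> ^^ i) w) = P \<frown> y"
  shows "suffix_of_blocks y (blocks \<tau> v a b w)"
proof -
  let ?B = "blocks \<tau> v a b w"
  let ?u = "\<lambda>i. ?B (- int n + int i)"
  let ?L = "concat (map (\<lambda>i. (subst_word \<tau> ^^ i) v) (rev [0..<n]))"
  have ne: "?u i \<noteq> []" if "i \<ge> Suc n" for i
    using that assms(1) subst_iter_nonempty by (simp add: blocks_def)
  have left: "map ?u [0..<n] = map (\<lambda>i. (subst_word \<tau> ^^ i) v) (rev [0..<n])"
    by (rule nth_equalityI) (auto simp: blocks_def rev_nth nat_diff_distrib' intro!: arg_cong[of _ _ "\<lambda>k. (subst_word \<tau> ^^ k) v"])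
  have right: "?u (Suc n + i) = (subst_word \<tau> ^^ i) w" for i
    by (simp add: blocks_def)
  have "concat_seq ?u = concat (map ?u [0..<Suc n]) \<frown> concat_seq (\<lambda>i. ?u (Suc n + i))"
    by (rule concat_seq_split[OF ne])
  also have "concat (map ?u [0..<Suc n]) = ?L @ a @ b"
    using left by (simp add: blocks_def)
  also have "(\<lambda>i. ?u (Suc n + i)) = (\<lambda>i. (subst_word \<tau> ^^ i) w)"
    using right by (intro ext)
  finally have "suffix (length P) (concat_seq ?u) = y"
    using assms(2) by simp
  moreover obtain r j where "j < length (?u r)"
    "suffix (length P) (concat_seq ?u) = suffix j (concat_seq (\<lambda>i. ?u (r + i)))"
    using concat_seq_position[of "Suc n" ?u "length P", OF ne] by blast
  moreover have "(\<lambda>i. ?u (r + i)) = (\<lambda>i. ?B ((- int n + int r) + int i))"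
    by (intro ext arg_cong[of _ _ ?B]) simp
  ultimately show ?thesis
    unfolding suffix_of_blocks_def funpow_shift
    by (intro exI[of _ "- int n + int r"] exI[of _ j]) simp
qed

end

section \<open>Stabilising a power of the substitution\<close>

definition occurs_twice :: "('a \<Rightarrow> 'a list) \<Rightarrow> 'a \<Rightarrow> bool" where
  "occurs_twice \<sigma> c \<longleftrightarrow> (\<exists>p w. \<sigma> c = p @ c # w \<and> c \<in> set w)"

text \<open>Marks an occurrence of \<open>c\<close> after which no letter leads to \<open>c\<close>.
  Excluding \<open>c\<close> from all iterates of \<open>w\<close>, and not only from
  \<open>w\<close>, is what makes the property pass to powers.\<close>

definition occurs_last :: "('a \<Rightarrow> 'a list) \<Rightarrow> 'a \<Rightarrow> bool" where
  "occurs_last \<sigma> c \<longleftrightarrow>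
     (\<exists>p w. \<sigma> c = p @ c # w \<and> (\<forall>i. c \<notin> set ((subst_word \<sigma> ^^ i) w)))"

definition occurs_first :: "('a \<Rightarrow> 'a list) \<Rightarrow> 'a \<Rightarrow> bool" where
  "occurs_first \<sigma> c \<longleftrightarrow> (\<exists>w. \<sigma> c = c # w)"

lemma occurs_twice_power:
  assumes "occurs_twice \<sigma> c" "n \<ge> 1"
  shows "occurs_twice (subst_power \<sigma> n) c"
proof -
  from assms(1) obtain p w where pw: "\<sigma> c = p @ c # w" "c \<in> set w"
    by (auto simp: occurs_twice_def)
  from assms(2) obtain m where "n = Suc m" by (cases n) auto
  \<comment> \<open>Because \<open>n \<ge> 1\<close>, the block with \<open>i = 0\<close>, which is
    \<open>w\<close> itself, is part of the right-hand word.\<close>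
  then have "c \<in> set (concat (map (\<lambda>i. (subst_word \<sigma> ^^ i) w) [0..<n]))"
    using pw(2) by (simp add: upt_conv_Cons del: upt_Suc)
  then show ?thesis
    unfolding occurs_twice_def subst_power_def subst_iter_occurrence[of \<sigma> c p w, OF pw(1)] by blast
qed

lemma occurs_last_power:
  assumes "occurs_last \<sigma> c"
  shows "occurs_last (subst_power \<sigma> n) c"
proof -
  from assms obtain p w where pw: "\<sigma> c = p @ c # w" "\<And>i. c \<notin> set ((subst_word \<sigma> ^^ i) w)"
    by (auto simp: occurs_last_def)
  have "c \<notin> set ((subst_word (subst_power \<sigma> n) ^^ i)
      (concat (map (\<lambda>i. (subst_word \<sigma> ^^ i) w) [0..<n])))" for i
    by (auto simp: subst_iter_power subst_iter_concat subst_iter_add pw(2))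
  then show ?thesis
    unfolding occurs_last_def subst_power_def[of \<sigma> n c] subst_iter_occurrence[of \<sigma> c p w, OF pw(1)] by blast
qed

lemma occurs_first_power:
  assumes "occurs_first \<sigma> c"
  shows "occurs_first (subst_power \<sigma> n) c"
proof -
  from assms obtain w where w: "\<sigma> c = [] @ c # w" by (auto simp: occurs_first_def)
  have "concat (map (\<lambda>i. (subst_word \<sigma> ^^ i) []) (rev [0..<n])) = []"
    unfolding concat_eq_Nil_conv by simp
  then show ?thesis
    unfolding occurs_first_def subst_power_def subst_iter_occurrence[of \<sigma> c "[]" w, OF w]
    by (simp only: append_Nil) blast
qed

text \<open>The predicates pass to multiples, so the product of one witness for each satisfiable
  member of \<open>F\<close> is a witness for all of them.\<close>

lemma common_multiple:
  fixes F :: "(nat \<Rightarrow> bool) set"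
  assumes "finite F" "\<And>P j r. P \<in> F \<Longrightarrow> P j \<Longrightarrow> r \<ge> 1 \<Longrightarrow> P (j * r)"
  shows "\<exists>m\<ge>1. \<forall>P\<in>F. (\<exists>j\<ge>1. P j) \<longrightarrow> P m"
  using assms
proof (induction F)
  case (insert P F)
  have "\<exists>m\<ge>1. \<forall>P\<in>F. (\<exists>j\<ge>1. P j) \<longrightarrow> P m"
    by (rule insert.IH) (rule insert.prems, simp_all)
  then obtain m where m: "m \<ge> 1" "\<forall>P\<in>F. (\<exists>j\<ge>1. P j) \<longrightarrow> P m"
    by (elim exE conjE)
  show ?case
  proof (cases "\<exists>j\<ge>1. P j")
    case True
    then obtain j where j: "j \<ge> 1" "P j" by blast
    have Q: "Q (m * j)" if "Q \<in> F" "\<exists>j\<ge>1. Q j" for Q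
      by (rule insert.prems) (use that(1) m(2)[rule_format, OF that] j(1) in simp_all)
    have "P (j * m)" by (rule insert.prems) (use j m(1) in simp_all)
    moreover have "j * m \<ge> 1" using j(1) m(1) by simp
    moreover have "\<forall>Q\<in>F. (\<exists>j\<ge>1. Q j) \<longrightarrow> Q (j * m)"
    proof (intro ballI impI)
      fix Q assume "Q \<in> F" "\<exists>j\<ge>1. Q j"
      from Q[OF this] show "Q (j * m)" by (simp only: mult.commute)
    qed
    ultimately show ?thesis by (intro exI[of _ "j * m"]) simp
  next
    case False
    have "(\<exists>j\<ge>1. P j) \<longrightarrow> P m" by (rule impI) (rule notE[OF False])
    with m show ?thesis unfolding ball_simps(7) by (intro exI[of _ m] conjI)
  qed
qed auto

definition power_stable :: "('a \<Rightarrow> 'a list) \<Rightarrow> bool" where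
  "power_stable \<tau> \<longleftrightarrow> (\<forall>c. \<forall>G \<in> {occurs_twice, occurs_last, occurs_first}.
     (\<exists>n\<ge>1. G (subst_power \<tau> n) c) \<longrightarrow> G \<tau> c)"

text \<open>There are finitely many pairs of a property and a letter, and
  \<open>common_multiple\<close> treats them together. Powers of \<open>subst_power \<phi> m\<close>
  are powers of \<open>\<phi>\<close>, so whatever property one of them has is already present at
  \<open>m\<close>.\<close>

lemma power_stable_subst_power:
  fixes \<phi> :: "'a::finite \<Rightarrow> 'a list"
  obtains m where "m \<ge> 1" "power_stable (subst_power \<phi> m)"
proof -
  let ?G = "{occurs_twice, occurs_last, occurs_first} :: (('a \<Rightarrow> 'a list) \<Rightarrow> 'a \<Rightarrow> bool) set"
  let ?F = "(\<lambda>(G, c). \<lambda>j. G (subst_power \<phi> j) c) ` (?G \<times> UNIV)"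
  have pow: "G (subst_power \<sigma> n) c" if "G \<in> ?G" "G \<sigma> c" "n \<ge> 1" for G n and \<sigma> :: "'a \<Rightarrow> 'a list" and c
    using that occurs_twice_power occurs_last_power occurs_first_power by auto
  have "\<exists>m\<ge>1. \<forall>P\<in>?F. (\<exists>j\<ge>1. P j) \<longrightarrow> P m"
  proof (rule common_multiple)
    show "finite ?F" by simp
  next
    fix P and j r :: nat
    assume "P \<in> ?F" "P j" "r \<ge> 1"
    then obtain G c where G: "G \<in> ?G" "P = (\<lambda>j. G (subst_power \<phi> j) c)"
      by (elim imageE) (simp only: mem_Times_iff split: prod.splits, simp)
    show "P (j * r)"
      using pow[OF G(1), of "subst_power \<phi> j" c r] \<open>P j\<close> \<open>r \<ge> 1\<close>
      unfolding G(2) subst_power_power by blast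
  qed
  then obtain m where m: "m \<ge> 1" "\<forall>P\<in>?F. (\<exists>j\<ge>1. P j) \<longrightarrow> P m"
    by (elim exE conjE)
  have "power_stable (subst_power \<phi> m)"
    unfolding power_stable_def
  proof (intro allI ballI impI)
    fix c G
    assume G: "G \<in> ?G" and "\<exists>n\<ge>1. G (subst_power (subst_power \<phi> m) n) c"
    then obtain n where n: "n \<ge> 1" "G (subst_power \<phi> (m * n)) c"
      unfolding subst_power_power by blast
    have "(\<lambda>j. G (subst_power \<phi> j) c) \<in> ?F" using G by (intro image_eqI[of _ _ "(G, c)"]) auto
    from m(2)[THEN bspec, OF this] show "G (subst_power \<phi> m) c"
      using n m(1) by (auto intro!: exI[of _ "m * n"])
  qed
  with m(1) that show thesis by blast
qed

section \<open>Growing substitutions\<close>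

lemma growing_nonerasing: "growing \<phi> \<Longrightarrow> nonerasing \<phi>"
proof (unfold_locales, rule notI)
  fix a assume "growing \<phi>" and a: "\<phi> a = []"
  then have "\<forall>\<^sub>F n in sequentially. length (subst_power \<phi> n a) \<ge> 1"
    by (auto simp: growing_def filterlim_at_top)
  then obtain N where "length (subst_power \<phi> (Suc N) a) \<ge> 1"
    unfolding eventually_sequentially by (meson le_SucI order_refl)
  then show False by (simp only: subst_power_def subst_iter_Suc_singleton a subst_iter_Nil list.size)
qed

text \<open>A fixed letter would keep length one along all multiples of \<open>m\<close>. This later
  guarantees that \<open>q\<close> is nonempty when \<open>\<tau> d = d # q\<close>.\<close>

lemma growing_power_not_fixed:
  assumes "growing \<phi>" "m \<ge> 1"
  shows "subst_power \<phi> m a \<noteq> [a]"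
proof
  assume a: "subst_power \<phi> m a = [a]"
  have fixed: "subst_power \<phi> (m * n) a = [a]" for n
  proof -
    have "(subst_word (subst_power \<phi> m) ^^ n) [a] = [a]"
      by (induction n) (simp_all add: a)
    then show ?thesis by (simp add: subst_iter_power subst_power_def)
  qed
  have "\<forall>\<^sub>F n in sequentially. length (subst_power \<phi> n a) \<ge> 2"
    using assms(1) by (auto simp: growing_def filterlim_at_top)
  then obtain N where N: "\<And>n. n \<ge> N \<Longrightarrow> length (subst_power \<phi> n a) \<ge> 2"
    unfolding eventually_sequentially by blast
  have "m * N \<ge> N" using assms(2) by simp
  from N[OF this] show False by (simp add: fixed)
qed

section \<open>Desubstitution addresses\<close>

lemma last_occurrence_unique:
  assumes "xs @ a # ys = xs' @ a # ys'" "a \<notin> set ys" "a \<notin> set ys'"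
  shows "ys = ys'"
  using assms by (auto simp: append_eq_append_conv2 append_eq_Cons_conv Cons_eq_append_conv)

text \<open>The points \<open>y\<^sub>k = c k \<cdot> z k\<close> are successive desubstitutions of \<open>y\<^sub>0\<close>: the image of \<open>y\<^sub>k\<^sub>+\<^sub>1\<close>
  under \<open>\<tau>\<close> is \<open>p k \<cdot> y\<^sub>k\<close>, and \<open>y\<^sub>k\<close> starts inside the image of the first letter of \<open>y\<^sub>k\<^sub>+\<^sub>1\<close>.\<close>

locale address = nonerasing \<tau> for \<tau> :: "'a::finite \<Rightarrow> 'a list" +
  fixes c :: "nat \<Rightarrow> 'a" and p t :: "nat \<Rightarrow> 'a list" and z :: "nat \<Rightarrow> nat \<Rightarrow> 'a"
  assumes letter: "\<tau> (c (Suc k)) = p k @ c k # t k"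
    and tail: "z k = t k \<frown> subst_seq \<tau> (z (Suc k))"
begin

text \<open>The part of \<open>z k\<close> determined by the \<open>n\<close> steps from
  \<open>k\<close> on. It may stay bounded as \<open>n\<close> grows, which is why the sequences
  \<open>z\<close> are parameters of the locale instead of limits of these words.\<close>

definition tail_word :: "nat \<Rightarrow> nat \<Rightarrow> 'a list" where
  "tail_word k n = concat (map (\<lambda>i. (subst_word \<tau> ^^ i) (t (k + i))) [0..<n])"

lemma tail_word_0 [simp]: "tail_word k 0 = []"
  by (simp add: tail_word_def)

lemma tail_word_Suc: "tail_word k (Suc n) = tail_word k n @ (subst_word \<tau> ^^ n) (t (k + n))"
  by (simp add: tail_word_def)

lemma tail_word_add: "tail_word k (n + n') = tail_word k n @ (subst_word \<tau> ^^ n) (tail_word (k + n) n')"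
  by (induction n') (simp_all add: tail_word_Suc subst_iter_add add.assoc)

text \<open>Turns a return of the sequence \<open>c\<close> to a letter into an occurrence of that
  letter in one of its own iterated images, with the word to its right known.\<close>

lemma letter_iter: "\<exists>P. (subst_word \<tau> ^^ n) [c (k + n)] = P @ c k # tail_word k n"
proof (induction n)
  case (Suc n)
  then obtain P where P: "(subst_word \<tau> ^^ n) [c (k + n)] = P @ c k # tail_word k n" by blast
  have "(subst_word \<tau> ^^ Suc n) [c (k + Suc n)] =
      (subst_word \<tau> ^^ n) (p (k + n) @ [c (k + n)] @ t (k + n))"
    unfolding subst_iter_Suc_singleton by (simp add: letter)
  also have "\<dots> = ((subst_word \<tau> ^^ n) (p (k + n)) @ P) @ c k # tail_word k (Suc n)"
    unfolding subst_iter_append P tail_word_Suc by simp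
  finally show ?case by blast
qed simp

lemma tail_iter: "z k = tail_word k n \<frown> (subst_seq \<tau> ^^ n) (z (k + n))"
proof (induction n)
  case (Suc n)
  have "(subst_seq \<tau> ^^ n) (z (k + n)) =
      (subst_word \<tau> ^^ n) (t (k + n)) \<frown> (subst_seq \<tau> ^^ Suc n) (z (k + Suc n))"
    by (subst tail) (simp add: subst_seq_iter_conc funpow_swap1)
  then show ?case
    by (subst Suc) (simp only: tail_word_Suc conc_conc)
qed simp

section \<open>Case one: infinitely many \<open>t k\<close> contain a letter leading to
  \<open>a\<close>\<close>

text \<open>There are cycles from \<open>a\<close> to itself of lengths \<open>L1\<close> (through \<open>c k\<close>) and \<open>L2\<close> (through \<open>b\<close>); repeated
  \<open>L2\<close> and \<open>L1\<close> times respectively, they give two different occurrences of \<open>a\<close> in \<open>\<tau>\<^sup>L\<^sup>1\<^sup>L\<^sup>2(a)\<close>.\<close>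

lemma recurrent_case_twice:
  assumes "c i = a" "i \<le> k" "b \<in> set (t k)" "a \<in> set ((subst_word \<tau> ^^ n) [b])"
    and "k < j" "c j = a"
  shows "\<exists>L\<ge>1. occurs_twice (subst_power \<tau> L) a"
proof -
  define \<alpha> where "\<alpha> = j - k"
  define L1 where "L1 = (k - i) + \<alpha>"
  define L2 where "L2 = n + \<alpha>"
  have \<alpha>: "j = k + \<alpha>" "\<alpha> \<ge> 1" using assms(5) by (auto simp: \<alpha>_def)
  obtain P where P: "(subst_word \<tau> ^^ \<alpha>) [a] = P @ c k # tail_word k \<alpha>"
    using letter_iter[of \<alpha> k] \<alpha>(1) assms(6) by auto
  have b: "b \<in> set (tail_word k \<alpha>)"
    using assms(3) tail_word_add[of k 1 "\<alpha> - 1"] \<alpha>(2) by (simp add: tail_word_Suc)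
  have ck: "a \<in> set ((subst_word \<tau> ^^ (k - i)) [c k])"
    using letter_iter[of "k - i" i] assms(1,2) by auto
  have "a \<in> set ((subst_word \<tau> ^^ L1) [a])"
    unfolding L1_def by (rule subst_iter_set_trans[OF _ ck]) (simp add: P)
  from subst_iter_cycle[OF this, of "L2 - 1"] ck
  have 1: "a \<in> set ((subst_word \<tau> ^^ ((L2 - 1) * L1 + (k - i))) [c k])"
    by (rule subst_iter_set_trans[rotated])
  have "a \<in> set ((subst_word \<tau> ^^ L2) [a])"
    unfolding L2_def by (rule subst_iter_set_trans[OF _ assms(4)]) (simp add: P b)
  from subst_iter_cycle[OF this, of "L1 - 1"] assms(4)
  have "a \<in> set ((subst_word \<tau> ^^ ((L1 - 1) * L2 + n)) [b])"
    by (rule subst_iter_set_trans[rotated])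
  then have 2: "a \<in> set ((subst_word \<tau> ^^ ((L1 - 1) * L2 + n)) (tail_word k \<alpha>))"
    using subst_iter_set_trans[of b 0 \<tau> "tail_word k \<alpha>"] b by simp
  have L: "L1 \<ge> 1" "L2 \<ge> 1" using \<alpha>(2) by (auto simp: L1_def L2_def)
  \<comment> \<open>Both repeated cycles begin with a leg of length \<open>\<alpha>\<close>, from
    \<open>a\<close> to \<open>c k\<close> and to \<open>b\<close> respectively. Removing it leaves
    the same exponent, so both occurrences of \<open>a\<close> lie in the same iterate of
    \<open>P @ c k # tail_word k \<alpha>\<close>.\<close>
  have e1: "(L2 - 1) * L1 + (k - i) = L1 * L2 - \<alpha>"
    using L by (simp add: algebra_simps diff_mult_distrib) (simp add: L1_def)
  have e2: "(L1 - 1) * L2 + n = L1 * L2 - \<alpha>"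
    using L by (simp add: algebra_simps diff_mult_distrib) (simp add: L2_def)
  have "\<alpha> * 1 \<le> L1 * L2" by (rule mult_le_mono) (use L in \<open>simp_all add: L1_def\<close>)
  then have "\<alpha> \<le> L1 * L2" by simp
  then have "(subst_word \<tau> ^^ (L1 * L2)) [a] =
      (subst_word \<tau> ^^ (L1 * L2 - \<alpha>)) ((subst_word \<tau> ^^ \<alpha>) [a])"
    by (simp add: subst_iter_add)
  also have "\<dots> = (subst_word \<tau> ^^ (L1 * L2 - \<alpha>)) (P @ [c k] @ tail_word k \<alpha>)"
    unfolding P by simp
  finally have eq: "(subst_word \<tau> ^^ (L1 * L2)) [a] = (subst_word \<tau> ^^ (L1 * L2 - \<alpha>)) P @
      (subst_word \<tau> ^^ (L1 * L2 - \<alpha>)) [c k] @ (subst_word \<tau> ^^ (L1 * L2 - \<alpha>)) (tail_word k \<alpha>)"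
    by (simp only: subst_iter_append)
  from 1 obtain u v where "(subst_word \<tau> ^^ (L1 * L2 - \<alpha>)) [c k] = u @ a # v"
    unfolding e1 by (blast dest: split_list)
  with eq 2 have "occurs_twice (subst_power \<tau> (L1 * L2)) a"
    unfolding occurs_twice_def subst_power_def e2
    by (intro exI[of _ "(subst_word \<tau> ^^ (L1 * L2 - \<alpha>)) P @ u"]
        exI[of _ "v @ (subst_word \<tau> ^^ (L1 * L2 - \<alpha>)) (tail_word k \<alpha>)"]) simp
  moreover have "L1 * L2 \<ge> 1" using L by simp
  ultimately show ?thesis by blast
qed

lemma tail_word_long:
  assumes "\<exists>\<^sub>\<infinity>k. t k \<noteq> []"
  shows "\<exists>n. \<forall>m\<ge>n. N \<le> length (tail_word 0 m)"
proof (induction N)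
  case (Suc N)
  then obtain n where n: "\<And>m. m \<ge> n \<Longrightarrow> N \<le> length (tail_word 0 m)" by blast
  from assms obtain k where k: "k \<ge> n" "t k \<noteq> []" unfolding INFM_nat_le by blast
  have "Suc N \<le> length (tail_word 0 m)" if "m \<ge> Suc k" for m
  proof -
    obtain d where d: "m = Suc k + d" using \<open>m \<ge> Suc k\<close> le_Suc_ex by blast
    have "length (tail_word 0 (Suc k)) \<le> length (tail_word 0 m)" unfolding d by (simp only: tail_word_add length_append)
    moreover have "length ((subst_word \<tau> ^^ k) (t k)) > 0"
      using subst_iter_nonempty[OF k(2)] by simp
    ultimately show ?thesis
      using n[OF k(1)] unfolding tail_word_Suc length_append by (simp del: length_greater_0_conv)
  qed
  then show ?case by blast
qed simp

text \<open>A prefix of the left point lies in some \<open>\<tau>\<^sup>k(a)\<close>, hence in the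
  block \<open>\<tau>\<^sup>k(w)\<close> of the right one. A prefix of the right point lies in some
  \<open>\<tau>\<^sup>N(a)\<close>, hence by way of \<open>b\<close> in a piece
  \<open>\<tau>\<^sup>k(t k)\<close> of the left one.\<close>

lemma recurrent_case_orbit_closure:
  assumes a: "\<exists>\<^sub>\<infinity>k. c k = a" and b: "\<exists>\<^sub>\<infinity>k. b \<in> set (t k)"
    and ab: "a \<in> set ((subst_word \<tau> ^^ n) [b])"
    and v: "\<tau> a = v @ a # w" and w: "a \<in> set w"
  shows "orbit_closure ([c 0] \<frown> z 0) = orbit_closure ([a] \<frown> concat_seq (\<lambda>i. (subst_word \<tau> ^^ i) w))"
    (is "orbit_closure ?y = orbit_closure ?y'")
proof (rule orbit_closure_eqI)
  let ?u = "\<lambda>i. (subst_word \<tau> ^^ i) w"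
  have ne: "?u i \<noteq> []" for i using w subst_iter_nonempty by (metis empty_iff empty_set)
  have split: "concat_seq ?u = concat (map ?u [0..<k]) \<frown> concat_seq (\<lambda>i. ?u (k + i))" for k
    by (rule concat_seq_split[of 0 ?u k, OF ne])
  show "?y \<in> orbit_closure ?y'"
    unfolding orbit_closure_iff
  proof
    fix N
    have "\<exists>\<^sub>\<infinity>k. t k \<noteq> []" by (rule frequently_elim1[OF b]) auto
    from tail_word_long[OF this] obtain m where m: "\<And>k. k \<ge> m \<Longrightarrow> N \<le> length (tail_word 0 k)" by blast
    from a obtain k where k: "k \<ge> m" "c k = a" unfolding INFM_nat_le by blast
    have "?y = (c 0 # tail_word 0 k) \<frown> (subst_seq \<tau> ^^ k) (z k)"
      by (subst tail_iter[of 0 k]) simp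
    then have "prefix N ?y = take N (c 0 # tail_word 0 k)"
      using m[OF k(1)] by (simp only: prefix_conc_fst list.size)
    then have "sublist (prefix N ?y) (c 0 # tail_word 0 k)" by simp
    also have "sublist (c 0 # tail_word 0 k) ((subst_word \<tau> ^^ k) [a])"
      using letter_iter[of k 0] k(2) by auto
    also have "sublist ((subst_word \<tau> ^^ k) [a]) (?u k)"
      by (rule subst_iter_sublist[OF sublist_singleton[OF w]])
    finally have "sublist (prefix N ?y) (?u k)" .
    moreover have "?y' = (([a] @ concat (map ?u [0..<k])) @ ?u k @ []) \<frown> concat_seq (\<lambda>i. ?u (Suc k + i))"
      by (subst split[of "Suc k"]) simp
    then have "?u k \<in> factors ?y'" by (rule factorsI)
    ultimately show "prefix N ?y \<in> factors ?y'" using sublist_in_factors by blast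
  qed
  show "?y' \<in> orbit_closure ?y"
    unfolding orbit_closure_iff
  proof
    fix N
    \<comment> \<open>Of the \<open>k\<close> levels, \<open>n\<close> lead from \<open>b\<close> to
      \<open>a\<close>, and at least \<open>N\<close> must remain so that the iterate of
      \<open>a\<close> contains \<open>\<tau>\<^sup>N(a)\<close>.\<close>
    from b obtain k where k: "k \<ge> N + n" "b \<in> set (t k)" unfolding INFM_nat_le by blast
    have "N \<le> length (concat (map ?u [0..<N]))"
      using length_concat_ge[of 0 ?u N, OF ne] by simp
    moreover have "?y' = (a # concat (map ?u [0..<N])) \<frown> concat_seq (\<lambda>i. ?u (N + i))"
      by (subst split[of N]) simp
    ultimately have "prefix N ?y' = take N (a # concat (map ?u [0..<N]))"
      by (simp only: prefix_conc_fst list.size)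
    then have "sublist (prefix N ?y') (a # concat (map ?u [0..<N]))" by simp
    also have "sublist (a # concat (map ?u [0..<N])) ((subst_word \<tau> ^^ N) [a])"
      unfolding subst_iter_occurrence[of \<tau> a v w, OF v] by simp
    also have "sublist ((subst_word \<tau> ^^ N) [a]) ((subst_word \<tau> ^^ (N + (k - n - N))) [a])"
    proof -
      have "a \<in> set ((subst_word \<tau> ^^ 1) [a])" by (simp add: v)
      from subst_iter_cycle[OF this, of "k - n - N"]
      have "sublist [a] ((subst_word \<tau> ^^ (k - n - N)) [a])" by (simp add: sublist_singleton)
      from subst_iter_sublist[OF this, where n = N and \<tau> = \<tau>] show ?thesis
        by (simp only: subst_iter_add)
    qed
    also have "N + (k - n - N) = k - n" using k(1) by simp
    also have "sublist ((subst_word \<tau> ^^ (k - n)) [a]) ((subst_word \<tau> ^^ (k - n + n)) [b])"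
      using subst_iter_sublist[OF sublist_singleton[OF ab], where n = "k - n" and \<tau> = \<tau>]
      by (simp only: subst_iter_add)
    also have "k - n + n = k" using k(1) by simp
    also have "sublist ((subst_word \<tau> ^^ k) [b]) ((subst_word \<tau> ^^ k) (t k))"
      by (rule subst_iter_sublist[OF sublist_singleton[OF k(2)]])
    finally have "sublist (prefix N ?y') ((subst_word \<tau> ^^ k) (t k))" .
    moreover have "?y = (([c 0] @ tail_word 0 k) @ (subst_word \<tau> ^^ k) (t k) @ []) \<frown> (subst_seq \<tau> ^^ Suc k) (z (Suc k))"
      by (subst tail_iter[of 0 "Suc k"]) (simp add: tail_word_Suc)
    then have "(subst_word \<tau> ^^ k) (t k) \<in> factors ?y" by (rule factorsI)
    ultimately show "prefix N ?y' \<in> factors ?y" using sublist_in_factors by blast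
  qed
qed

section \<open>Case two: from some index on, no letter of \<open>t k\<close> leads to
  \<open>a\<close>\<close>

lemma not_in_tail_word:
  assumes "\<And>k b n. k \<ge> i \<Longrightarrow> b \<in> set (t k) \<Longrightarrow> a \<notin> set ((subst_word \<tau> ^^ n) [b])"
  shows "a \<notin> set ((subst_word \<tau> ^^ n) (tail_word i m))"
proof
  assume "a \<in> set ((subst_word \<tau> ^^ n) (tail_word i m))"
  then obtain l where "a \<in> set ((subst_word \<tau> ^^ (n + l)) (t (i + l)))"
    by (auto simp: tail_word_def subst_iter_concat subst_iter_add)
  \<comment> \<open>Cutting \<open>t (i + l)\<close> into single letters traces the occurrence of
    \<open>a\<close> back to one letter \<open>b\<close>.\<close>
  moreover have "(subst_word \<tau> ^^ (n + l)) (concat (map (\<lambda>b. [b]) (t (i + l)))) =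
      concat (map (\<lambda>b. (subst_word \<tau> ^^ (n + l)) [b]) (t (i + l)))"
    unfolding subst_iter_concat by (simp add: comp_def)
  ultimately obtain b where "b \<in> set (t (i + l))" "a \<in> set ((subst_word \<tau> ^^ (n + l)) [b])"
    by auto
  with assms[of "i + l"] show False by simp
qed

lemma last_case_occurs_last:
  assumes "c i = a" "i < j" "c j = a"
    and "\<And>k b n. k \<ge> i \<Longrightarrow> b \<in> set (t k) \<Longrightarrow> a \<notin> set ((subst_word \<tau> ^^ n) [b])"
  shows "\<exists>L\<ge>1. occurs_last (subst_power \<tau> L) a"
proof -
  obtain P where "(subst_word \<tau> ^^ (j - i)) [a] = P @ a # tail_word i (j - i)"
    using letter_iter[of "j - i" i] assms(1-3) by auto
  then have "subst_power \<tau> (j - i) a = P @ a # tail_word i (j - i)" by (simp add: subst_power_def)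
  moreover have "\<forall>n. a \<notin> set ((subst_word (subst_power \<tau> (j - i)) ^^ n) (tail_word i (j - i)))"
    unfolding subst_iter_power by (intro allI not_in_tail_word assms(4))
  ultimately have "occurs_last (subst_power \<tau> (j - i)) a"
    unfolding occurs_last_def by blast
  then show ?thesis using assms(2) by (intro exI[of _ "j - i"]) simp
qed

text \<open>Applying \<open>\<tau>\<close> to the \<open>i\<close>-th desubstituted point
  \<open>i\<close> times gives a sequence with the original point as a suffix, so a description of
  the former carries over to the latter.\<close>

lemma iter_eq_conc: "\<exists>P. (subst_word \<tau> ^^ i) [c i] \<frown> (subst_seq \<tau> ^^ i) (z i) = P \<frown> ([c 0] \<frown> z 0)"
proof -
  obtain P where "(subst_word \<tau> ^^ i) [c i] = P @ c 0 # tail_word 0 i"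
    using letter_iter[of i 0] by auto
  moreover have "[c 0] \<frown> z 0 = (c 0 # tail_word 0 i) \<frown> (subst_seq \<tau> ^^ i) (z i)"
    by (subst tail_iter[of 0 i]) simp
  ultimately show ?thesis by (simp only: conc_conc) blast
qed

text \<open>Both words are what follows the last \<open>a\<close> in the same iterate of
  \<open>a\<close>, since neither of them contains \<open>a\<close>.\<close>

lemma tail_word_eq_last_occurrence:
  assumes "c i = a" "i \<le> j" "c j = a"
    and "\<And>k b n. k \<ge> i \<Longrightarrow> b \<in> set (t k) \<Longrightarrow> a \<notin> set ((subst_word \<tau> ^^ n) [b])"
    and "\<tau> a = v @ a # w" "\<And>n. a \<notin> set ((subst_word \<tau> ^^ n) w)"
  shows "tail_word i (j - i) = concat (map (\<lambda>i. (subst_word \<tau> ^^ i) w) [0..<j - i])" (is "_ = ?R")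
proof -
  obtain P where P: "(subst_word \<tau> ^^ (j - i)) [a] = P @ a # tail_word i (j - i)"
    using letter_iter[of "j - i" i] assms(1-3) by auto
  have "a \<notin> set ((subst_word \<tau> ^^ 0) (tail_word i (j - i)))" by (rule not_in_tail_word[OF assms(4)])
  then have "a \<notin> set (tail_word i (j - i))" by simp
  moreover have "a \<notin> set ?R" using assms(6) by simp
  ultimately show ?thesis
    by (intro last_occurrence_unique[OF P[symmetric, unfolded
          subst_iter_occurrence[of \<tau> a v w, OF assms(5)]]])
qed

text \<open>Returns of \<open>c\<close> to \<open>a\<close> at arbitrarily large indices make
  \<open>z i\<close> equal to \<open>w \<tau>(w) \<tau>\<^sup>2(w) \<cdots>\<close>. Applying
  \<open>\<tau>\<close> another \<open>i\<close> times creates the left part from \<open>v\<close>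
  and keeps the right part in place after \<open>a\<close>.\<close>

lemma last_case_nonempty:
  assumes "\<exists>\<^sub>\<infinity>k. c k = a" "c i = a"
    and "\<And>k b n. k \<ge> i \<Longrightarrow> b \<in> set (t k) \<Longrightarrow> a \<notin> set ((subst_word \<tau> ^^ n) [b])"
    and "\<tau> a = v @ a # w" "\<And>n. a \<notin> set ((subst_word \<tau> ^^ n) w)" "w \<noteq> []"
  shows "suffix_of_blocks ([c 0] \<frown> z 0) (blocks \<tau> v [a] [] w)"
proof -
  let ?u = "\<lambda>i. (subst_word \<tau> ^^ i) w"
  let ?L = "concat (map (\<lambda>i. (subst_word \<tau> ^^ i) v) (rev [0..<i]))"
  have ne: "?u i \<noteq> []" for i using assms(6) by (rule subst_iter_nonempty)
  have z: "concat_seq ?u = z i"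
  proof (rule concat_seq_eqI)
    fix N
    from assms(1) obtain j where j: "j \<ge> i + Suc N" "c j = a" unfolding INFM_nat_le by blast
    have "z i = concat (map ?u [0..<j - i]) \<frown> (subst_seq \<tau> ^^ (j - i)) (z (i + (j - i)))"
      using tail_iter[of i "j - i"] tail_word_eq_last_occurrence[OF assms(2) _ j(2) assms(3-5)] j(1) by simp
    moreover have "N < length (concat (map ?u [0..<j - i]))"
      using length_concat_ge[of 0 ?u "j - i", OF ne] j(1) by simp
    ultimately show "\<exists>k s. N < length (concat (map ?u [0..<k])) \<and> z i = concat (map ?u [0..<k]) \<frown> s"
      by blast
  qed
  have "(subst_seq \<tau> ^^ i) (z i) = concat_seq (\<lambda>k. ?u (i + k))"
    unfolding z[symmetric] subst_seq_iter_concat_seq[of ?u, OF ne] by (simp only: subst_iter_add)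
  then have "(?L @ [a] @ []) \<frown> concat_seq ?u = (subst_word \<tau> ^^ i) [c i] \<frown> (subst_seq \<tau> ^^ i) (z i)"
    unfolding concat_seq_split[of 0 ?u i, OF ne] assms(2) subst_iter_occurrence[of \<tau> a v w, OF assms(4)]
    by simp
  with iter_eq_conc[of i] obtain P where "(?L @ [a] @ []) \<frown> concat_seq ?u = P \<frown> ([c 0] \<frown> z 0)"
    by auto
  then show ?thesis by (rule suffix_of_blocksI[OF assms(6)])
qed

text \<open>Here \<open>a\<close> produces nothing to its right, and the late sequences
  \<open>z k\<close> are images of one another. A first letter \<open>d\<close> shared by infinitely
  many of them begins its own iterated image; stability moves this to \<open>\<tau>\<close> itself
  and makes some \<open>z k\<close> the fixed point \<open>d q \<tau>(q) \<cdots>\<close>.\<close>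

lemma last_case_empty:
  assumes "\<exists>\<^sub>\<infinity>k. c k = a" "c i = a"
    and "\<And>k b n. k \<ge> i \<Longrightarrow> b \<in> set (t k) \<Longrightarrow> a \<notin> set ((subst_word \<tau> ^^ n) [b])"
    and "\<tau> a = v @ [a]"
    and "power_stable \<tau>" "\<And>d. \<tau> d \<noteq> [d]"
  shows "\<exists>d q. \<tau> d = d # q \<and> q \<noteq> [] \<and> suffix_of_blocks ([c 0] \<frown> z 0) (blocks \<tau> v [a] [d] q)"
proof -
  have tail_i: "tail_word i n = []" for n
  proof -
    from assms(1) obtain j where j: "j \<ge> i + n" "c j = a" unfolding INFM_nat_le by blast
    have "tail_word i (j - i) = concat (map (\<lambda>i. (subst_word \<tau> ^^ i) []) [0..<j - i])"
      by (rule tail_word_eq_last_occurrence[OF assms(2) _ j(2) assms(3,4)]) (use j(1) in simp_all)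
    then have "tail_word i (n + (j - i - n)) = []" using j(1) by (simp add: concat_eq_Nil_conv)
    then show ?thesis unfolding tail_word_add by simp
  qed
  \<comment> \<open>An iterate of \<open>tail_word k n\<close> is the end of a tail word starting at
    \<open>i\<close>, and nothing is erased.\<close>
  have tail_k: "tail_word k n = []" if "k \<ge> i" for k n
  proof (rule ccontr)
    assume "tail_word k n \<noteq> []"
    then have "(subst_word \<tau> ^^ (k - i)) (tail_word k n) \<noteq> []" by (rule subst_iter_nonempty)
    with tail_i[of "k - i + n"] that show False unfolding tail_word_add by simp
  qed
  have z: "z k = (subst_seq \<tau> ^^ n) (z (k + n))" if "k \<ge> i" for k n
    using tail_iter[of k n] tail_k[OF that] by simp
  obtain d where d: "\<exists>\<^sub>\<infinity>k. z k 0 = d" using recurrent_value[of "\<lambda>k. z k 0"] by blast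
  have zd: "z k = (subst_word \<tau> ^^ (j - k)) [d] \<frown> (subst_seq \<tau> ^^ (j - k)) (suffix 1 (z j))"
    if "k \<ge> i" "j \<ge> k" "z j 0 = d" for k j
  proof -
    have "z j = [d] \<frown> suffix 1 (z j)"
      using prefix_suffix[of "z j" 1] that(3) by (simp del: prefix_suffix)
    then have "(subst_seq \<tau> ^^ (j - k)) (z j) =
        (subst_word \<tau> ^^ (j - k)) [d] \<frown> (subst_seq \<tau> ^^ (j - k)) (suffix 1 (z j))"
      by (metis subst_seq_iter_conc)
    with z[OF that(1), of "j - k"] that(2) show ?thesis by simp
  qed
  from d obtain k where k: "k \<ge> i" "z k 0 = d" unfolding INFM_nat_le by blast
  from d obtain j where j: "j \<ge> Suc k" "z j 0 = d" unfolding INFM_nat_le by blast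
  obtain e l where el: "(subst_word \<tau> ^^ (j - k)) [d] = e # l"
    using subst_iter_nonempty[of "[d]" "j - k"] by (cases "(subst_word \<tau> ^^ (j - k)) [d]") auto
  have "e = d" using zd[OF k(1) _ j(2)] j(1) k(2) unfolding el by simp
  then have "occurs_first (subst_power \<tau> (j - k)) d"
    using el by (simp add: occurs_first_def subst_power_def)
  moreover have "j - k \<ge> 1" using j(1) by simp
  ultimately have "occurs_first \<tau> d"
    using assms(5) unfolding power_stable_def by blast
  then obtain q where q: "\<tau> d = d # q" by (auto simp: occurs_first_def)
  have "q \<noteq> []" using q assms(6)[of d] by auto
  let ?u = "\<lambda>i. (subst_word \<tau> ^^ i) q"
  have ne: "?u i \<noteq> []" for i using \<open>q \<noteq> []\<close> by (rule subst_iter_nonempty)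
  define \<zeta> where "\<zeta> = [d] \<frown> concat_seq ?u"
  have iter_d: "(subst_word \<tau> ^^ n) [d] = d # concat (map ?u [0..<n])" for n
    using subst_iter_occurrence[of \<tau> d "[]" q n] q by (simp add: concat_eq_Nil_conv)
  have "concat_seq ?u = suffix 1 (z k)"
  proof (rule concat_seq_eqI)
    fix N
    from d obtain j where j: "j \<ge> k + Suc N" "z j 0 = d" unfolding INFM_nat_le by blast
    have "z k = (d # concat (map ?u [0..<j - k])) \<frown> (subst_seq \<tau> ^^ (j - k)) (suffix 1 (z j))"
      using zd[OF k(1) _ j(2)] j(1) unfolding iter_d by simp
    then have "suffix 1 (z k) = concat (map ?u [0..<j - k]) \<frown> (subst_seq \<tau> ^^ (j - k)) (suffix 1 (z j))"
      by simp
    moreover have "N < length (concat (map ?u [0..<j - k]))"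
      using length_concat_ge[of 0 ?u "j - k", OF ne] j(1) by simp
    ultimately show "\<exists>n s. N < length (concat (map ?u [0..<n])) \<and>
        suffix 1 (z k) = concat (map ?u [0..<n]) \<frown> s" by blast
  qed
  then have zk: "z k = \<zeta>"
    using prefix_suffix[of "z k" 1] k(2) by (simp add: \<zeta>_def del: prefix_suffix)
  \<comment> \<open>Being fixed by \<open>\<tau>\<close>, the sequence \<open>\<zeta>\<close> passes
    from index \<open>k\<close> back to \<open>i\<close>, and then through the remaining
    \<open>i\<close> levels, unchanged.\<close>
  have "(subst_seq \<tau> ^^ n) \<zeta> = \<zeta>" for n
  proof -
    have "(subst_seq \<tau> ^^ n) \<zeta> = (d # concat (map ?u [0..<n])) \<frown> concat_seq (\<lambda>k. ?u (n + k))"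
      unfolding \<zeta>_def subst_seq_iter_conc iter_d subst_seq_iter_concat_seq[of ?u, OF ne]
      by (simp only: subst_iter_add)
    also have "\<dots> = \<zeta>"
      unfolding \<zeta>_def concat_seq_split[of 0 ?u n, OF ne] by simp
    finally show ?thesis .
  qed
  then have zi: "(subst_seq \<tau> ^^ i) (z i) = \<zeta>"
    using z[of i "k - i"] k(1) zk by simp
  let ?L = "concat (map (\<lambda>i. (subst_word \<tau> ^^ i) v) (rev [0..<i]))"
  have "(subst_word \<tau> ^^ i) [a] = ?L @ [a]"
    using subst_iter_occurrence[of \<tau> a v "[]" i] assms(4) by (simp add: concat_eq_Nil_conv)
  then have "(?L @ [a] @ [d]) \<frown> concat_seq ?u = (subst_word \<tau> ^^ i) [c i] \<frown> (subst_seq \<tau> ^^ i) (z i)"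
    unfolding zi \<zeta>_def assms(2) by simp
  with iter_eq_conc[of i] obtain P where "(?L @ [a] @ [d]) \<frown> concat_seq ?u = P \<frown> ([c 0] \<frown> z 0)"
    by auto
  then have "suffix_of_blocks ([c 0] \<frown> z 0) (blocks \<tau> v [a] [d] q)"
    by (rule suffix_of_blocksI[OF \<open>q \<noteq> []\<close>])
  with q \<open>q \<noteq> []\<close> show ?thesis by blast
qed

text \<open>The cases are separated by whether infinitely many \<open>t k\<close> contain a letter
  leading to \<open>a\<close>. The letters \<open>e\<close> and \<open>e'\<close> serve to bound the
  lengths of \<open>v\<close> and \<open>w\<close>, which allows a finite \<open>W\<close>
  independent of the point.\<close>

lemma transitive_point:
  assumes "power_stable \<tau>" "\<And>d. \<tau> d \<noteq> [d]"
  shows "\<exists>y v w a b e e'. orbit_closure ([c 0] \<frown> z 0) = orbit_closure y \<and>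
    length v \<le> length (\<tau> e) \<and> length w \<le> length (\<tau> e') \<and> w \<noteq> [] \<and>
    a \<in> letters_or_empty \<and> b \<in> letters_or_empty \<and> suffix_of_blocks y (blocks \<tau> v a b w)"
proof -
  obtain a where a: "\<exists>\<^sub>\<infinity>k. c k = a" using recurrent_value[of c] by blast
  let ?R = "\<lambda>k. \<exists>b\<in>UNIV. b \<in> set (t k) \<and> (\<exists>n. a \<in> set ((subst_word \<tau> ^^ n) [b]))"
  show ?thesis
  proof (cases "\<exists>\<^sub>\<infinity>k. ?R k")
    case True
    then have "\<exists>b\<in>UNIV. \<exists>\<^sub>\<infinity>k. b \<in> set (t k) \<and> (\<exists>n. a \<in> set ((subst_word \<tau> ^^ n) [b]))"
      by (subst (asm) frequently_bex_finite_distrib) auto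
    then obtain b where b: "\<exists>\<^sub>\<infinity>k. b \<in> set (t k) \<and> (\<exists>n. a \<in> set ((subst_word \<tau> ^^ n) [b]))"
      by blast
    then have bt: "\<exists>\<^sub>\<infinity>k. b \<in> set (t k)" by (rule frequently_elim1) simp
    from b obtain n where n: "a \<in> set ((subst_word \<tau> ^^ n) [b])"
      unfolding INFM_nat_le by blast
    from a obtain i where i: "c i = a" unfolding INFM_nat_le by blast
    from bt obtain k where k: "k \<ge> i" "b \<in> set (t k)" unfolding INFM_nat_le by blast
    from a obtain j where j: "j \<ge> Suc k" "c j = a" unfolding INFM_nat_le by blast
    have "\<exists>L\<ge>1. occurs_twice (subst_power \<tau> L) a"
      using recurrent_case_twice[OF i k n _ j(2)] j(1) by simp
    then have "occurs_twice \<tau> a" using assms(1) unfolding power_stable_def by blast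
    then obtain v w where vw: "\<tau> a = v @ a # w" "a \<in> set w" by (auto simp: occurs_twice_def)
    then have "w \<noteq> []" by auto
    \<comment> \<open>The left part is taken empty, as the chosen point begins with \<open>a\<close>
      itself.\<close>
    then have "suffix_of_blocks ([a] \<frown> concat_seq (\<lambda>i. (subst_word \<tau> ^^ i) w)) (blocks \<tau> [] [a] [] w)"
      by (rule suffix_of_blocksI[where n = 0 and P = "[]"]) simp
    moreover have "length w \<le> length (\<tau> a)" using vw(1) by simp
    ultimately show ?thesis
      using recurrent_case_orbit_closure[OF a bt n vw] \<open>w \<noteq> []\<close>
      by (intro exI[of _ "[a] \<frown> concat_seq (\<lambda>i. (subst_word \<tau> ^^ i) w)"] exI[of _ "[]"] exI[of _ w]
          exI[of _ "[a]"] exI[of _ a]) (simp add: letters_or_empty_def)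
  next
    case False
    then obtain K where K: "\<And>k. k \<ge> K \<Longrightarrow> \<not> ?R k" unfolding INFM_nat_le by blast
    from a obtain i where i: "i \<ge> K" "c i = a" unfolding INFM_nat_le by blast
    from a obtain j where j: "j \<ge> Suc i" "c j = a" unfolding INFM_nat_le by blast
    have nr: "a \<notin> set ((subst_word \<tau> ^^ n) [b])" if "k \<ge> i" "b \<in> set (t k)" for k b n
      using K[of k] i(1) that by auto
    have "\<exists>L\<ge>1. occurs_last (subst_power \<tau> L) a"
      using last_case_occurs_last[OF i(2) _ j(2) nr] j(1) by simp
    then have "occurs_last \<tau> a" using assms(1) unfolding power_stable_def by blast
    then obtain v w where vw: "\<tau> a = v @ a # w" "\<And>n. a \<notin> set ((subst_word \<tau> ^^ n) w)"
      by (auto simp: occurs_last_def)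
    have len: "length v \<le> length (\<tau> a)" "length w \<le> length (\<tau> a)" using vw(1) by simp_all
    have letters: "[] \<in> letters_or_empty" "[e] \<in> letters_or_empty" for e :: 'a
      by (simp_all add: letters_or_empty_def)
    show ?thesis
    proof (cases "w = []")
      case False
      have "suffix_of_blocks ([c 0] \<frown> z 0) (blocks \<tau> v [a] [] w)"
        by (rule last_case_nonempty[OF a i(2) nr vw False])
      with len False letters show ?thesis
        by (intro exI[of _ "[c 0] \<frown> z 0"] exI[of _ v] exI[of _ w] exI[of _ "[a]"] exI[of _ "[]"]
            exI[of _ a]) simp
    next
      case True
      have "\<tau> a = v @ [a]" using vw(1) True by simp
      have "\<exists>d q. \<tau> d = d # q \<and> q \<noteq> [] \<and>
          suffix_of_blocks ([c 0] \<frown> z 0) (blocks \<tau> v [a] [d] q)"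
        by (rule last_case_empty[OF a i(2) nr \<open>\<tau> a = v @ [a]\<close> assms])
      then obtain d q where q: "\<tau> d = d # q" "q \<noteq> []"
        "suffix_of_blocks ([c 0] \<frown> z 0) (blocks \<tau> v [a] [d] q)" by blast
      have "length q \<le> length (\<tau> d)" using q(1) by simp
      with q(2,3) len(1) letters show ?thesis
        by (intro exI[of _ "[c 0] \<frown> z 0"] exI[of _ v] exI[of _ q] exI[of _ "[a]"] exI[of _ "[d]"]
            exI[of _ a] exI[of _ d]) simp
    qed
  qed
qed

end

theorem theoremB:
  fixes \<phi> :: "'a::finite \<Rightarrow> 'a list" and x :: "nat \<Rightarrow> 'a" and X :: "(nat \<Rightarrow> 'a) set"
  assumes "growing \<phi>"
    and "subst_seq \<phi> x = x"
    and "X = orbit_closure x"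
  shows "\<exists>m \<tau> W. m \<ge> 1 \<and> \<tau> = subst_power \<phi> m \<and> finite W \<and>
    (\<forall>Y. transitive_subsystem Y \<and> Y \<subseteq> X \<longrightarrow>
      (\<exists>y\<in>X. Y = orbit_closure y \<and>
        (\<exists>v\<in>W. \<exists>w\<in>W - {[]}. \<exists>a\<in>letters_or_empty. \<exists>b\<in>letters_or_empty.
           suffix_of_blocks y (blocks \<tau> v a b w))))"
proof -
  interpret nonerasing \<phi> using assms(1) by (rule growing_nonerasing)
  obtain m where m: "m \<ge> 1" "power_stable (subst_power \<phi> m)" by (rule power_stable_subst_power)
  define \<tau> where "\<tau> = subst_power \<phi> m"
  have ne: "nonerasing \<tau>" unfolding \<tau>_def by (rule nonerasing_subst_power)
  have "(subst_seq \<phi> ^^ n) x = x" for n by (induction n) (simp_all add: assms(2))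
  then have x: "subst_seq \<tau> x = x" by (simp add: \<tau>_def subst_seq_power)
  define M where "M = Max (range (\<lambda>a. length (\<tau> a)))"
  have M: "length (\<tau> a) \<le> M" for a by (simp add: M_def)
  \<comment> \<open>All words no longer than the longest image of a letter.\<close>
  define W where "W = {w :: 'a list. set w \<subseteq> UNIV \<and> length w \<le> M}"
  have "finite W" unfolding W_def by (rule finite_lists_length_le) simp
  moreover have "\<exists>y\<in>X. Y = orbit_closure y \<and>
      (\<exists>v\<in>W. \<exists>w\<in>W - {[]}. \<exists>a\<in>letters_or_empty. \<exists>b\<in>letters_or_empty.
         suffix_of_blocks y (blocks \<tau> v a b w))" if Y: "transitive_subsystem Y" "Y \<subseteq> X" for Y
  proof -
    from Y(1) obtain y0 where y0: "y0 \<in> Y" "Y = orbit_closure y0"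
      by (auto simp: transitive_subsystem_def)
    let ?Q = "\<lambda>y y'. \<exists>p t. \<tau> (y' 0) = p @ y 0 # t \<and> suffix 1 y = t \<frown> subst_seq \<tau> (suffix 1 y')"
    \<comment> \<open>Desubstitution is repeated inside \<open>X\<close> by dependent choice; the
      clause for \<open>n = 0\<close> pins the start to the given generating point of
      \<open>Y\<close>.\<close>
    have "\<exists>y. \<forall>n. (y n \<in> X \<and> (n = 0 \<longrightarrow> y n = y0)) \<and> ?Q (y n) (y (Suc n))"
    proof (rule dependent_nat_choice)
      show "\<exists>y. y \<in> X \<and> (0 = (0::nat) \<longrightarrow> y = y0)" using y0(1) Y(2) by auto
    next
      fix y and n :: nat
      assume "y \<in> X \<and> (n = 0 \<longrightarrow> y = y0)"
      then have "y \<in> orbit_closure x" by (simp add: assms(3))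
      from desubstitute_orbit_closure[OF ne x this] obtain y' p t where
        "y' \<in> orbit_closure x" "\<tau> (y' 0) = p @ y 0 # t" "suffix 1 y = t \<frown> subst_seq \<tau> (suffix 1 y')" .
      then show "\<exists>y'. (y' \<in> X \<and> (Suc n = 0 \<longrightarrow> y' = y0)) \<and> ?Q y y'"
        unfolding assms(3) by blast
    qed
    then obtain y where y: "y 0 = y0" "\<And>n. ?Q (y n) (y (Suc n))" by blast
    then obtain p t where pt: "\<And>n. \<tau> (y (Suc n) 0) = p n @ y n 0 # t n"
      "\<And>n. suffix 1 (y n) = t n \<frown> subst_seq \<tau> (suffix 1 (y (Suc n)))" by metis
    interpret address \<tau> "\<lambda>n. y n 0" p t "\<lambda>n. suffix 1 (y n)"
      by (intro address.intro ne address_axioms.intro pt)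
    have "[y 0 0] \<frown> suffix 1 (y 0) = y0"
      using prefix_suffix[of y0 1] y(1) by (simp del: prefix_suffix)
    moreover have "\<tau> d \<noteq> [d]" for d
      unfolding \<tau>_def by (rule growing_power_not_fixed[OF assms(1) m(1)])
    ultimately obtain y' v w a b e e' where *: "Y = orbit_closure y'"
      "length v \<le> length (\<tau> e)" "length w \<le> length (\<tau> e')" "w \<noteq> []"
      "a \<in> letters_or_empty" "b \<in> letters_or_empty" "suffix_of_blocks y' (blocks \<tau> v a b w)"
      using transitive_point m(2) unfolding \<tau>_def[symmetric] y0(2) by auto
    have "v \<in> W" "w \<in> W - {[]}"
      using *(2-4) M[of e] M[of e'] by (simp_all add: W_def)
    moreover have "y' \<in> X" using *(1) Y(2) orbit_closure_self by blast
    ultimately show ?thesis using *(1,5-7) by blast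
  qed
  ultimately show ?thesis
    using m(1) by (intro exI[of _ m] exI[of _ \<tau>] exI[of _ W]) (simp add: \<tau>_def)
qed

end
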